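(* Let $f : \mathbb{R}^n \to \mathbb{R}$ be piecewise $p$-times continuously differentiable with selection functions $f_1, \dots, f_m$, $m \in \mathbb{N}$, and let $x^* \in \mathbb{R}^n$ be a minimum of order $p \in \mathbb{N}$ with constant $\beta > 0$ of $f$. Assume that for every $i \in \{1,\dots,m\}$ there is an open set $V_i \subseteq \mathbb{R}^n$ with $C_i(x^* ) \setminus \{0\} \subseteq V_i$ and $$\mathrm{d}^{(k)} f_i(x^* )(d)^k \geq 0 \quad \text{for all } k \in \{2,\dots,p\},\ d \in V_i.$$ Then $$\liminf_{\xi \in \partial f(x^* + t d'),\, t \searrow 0,\, d' \rightarrow d} \frac{\langle \xi, d' \rangle}{t^{p-1}} \geq \underline{\mathrm{d}}^p f(x^*,d) \quad \text{for all } d \in \mathbb{R}^n \setminus \{0\},$$ and, in particular, $$\liminf_{\xi \in \partial f(x^* + t d'),\, t \searrow 0,\, d' \rightarrow d} \frac{\langle \xi, d' \rangle}{t^{p-1}} \geq \beta \|d\|^p \quad \text{for all } d \in \mathbb{R}^n \setminus \{0\}.$$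
   Context: $\mathbb{N} = \{1,2,\dots\}$; $\|\cdot\|$ is the Euclidean norm and $\langle\cdot,\cdot\rangle$ the Euclidean inner product on $\mathbb{R}^n$. Piecewise $p$-times continuously differentiable: $f : \mathbb{R}^n \to \mathbb{R}$ is continuous and there are $p$-times continuously differentiable functions $f_1,\dots,f_m : \mathbb{R}^n \to \mathbb{R}$ (the selection functions) with $f(x) \in \{f_1(x),\dots,f_m(x)\}$ for all $x \in \mathbb{R}^n$. (Such $f$ is locally Lipschitz continuous.) The active set is $A(x) := \{ i \in \{1,\dots,m\} : f(x) = f_i(x)\}$. For $i \in \{1,\dots,m\}$, $C_i(x)$ is the set of all $d \in \mathbb{R}^n$ for which there are sequences $(d^j)_j$ in $\mathbb{R}^n$ and $(t_j)_j$ in $\mathbb{R}^{>0}$ with $d^j \to d$, $t_j \to 0$ and $i \in A(x + t_j d^j)$ for all $j \in \mathbb{N}$. For a $p$-times continuously differentiable function $g$ and $k \in \{1,\dots,p\}$: $\mathrm{d}^{(k)} g(x)(d)^k := \sum_{i_1=1}^n \cdots \sum_{i_k=1}^n \partial_{i_1}\cdots\partial_{i_k} g(x)\, d_{i_1}\cdots d_{i_k}$. Clarke subdifferential: for a locally Lipschitz continuous $f$ with set of non-differentiability points $\Omega$, $\partial f(x)$ is the convex hull of the set of all $\xi \in \mathbb{R}^n$ for which there is a sequence $(y^k)_k$ in $\mathbb{R}^n \setminus \Omega$ with $y^k \to x$ and $\nabla f(y^k) \to \xi$. Minimum of order $p$: $x^*$ is a minimum of order $p \in \mathbb{N}$ with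 constant $\beta > 0$ of $f$ if there is an open set $U \subseteq \mathbb{R}^n$ with $x^* \in U$ and $f(x) \geq f(x^* ) + \beta \|x - x^*\|^p$ for all $x \in U$. The $p$-order lower (Dini-Hadamard) directional derivative is $\underline{\mathrm{d}}^p f(x,d) := \liminf_{t \searrow 0,\, d' \to d} \frac{f(x + t d') - f(x)}{t^p} \in \mathbb{R} \cup \{-\infty,\infty\}$. The limit inferior on the left-hand sides in the claim is an element of $\mathbb{R} \cup \{-\infty,\infty\}$ and is the infimum of $\liminf_{k\to\infty} \langle \xi^k, d^k\rangle / t_k^{p-1}$ over all sequences with $t_k > 0$, $t_k \to 0$, $d^k \to d$ and $\xi^k \in \partial f(x^* + t_k d^k)$. *)

theory Defs
  imports "HOL-Analysis.Analysis"
begin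

definition partial_deriv :: "'n \<Rightarrow> (real^'n \<Rightarrow> real) \<Rightarrow> real^'n \<Rightarrow> real" where
  "partial_deriv i g x = deriv (\<lambda>s. g (x + s *\<^sub>R axis i 1)) 0"

text \<open>The partial derivatives are the components of the derivative, so the
  derivative of \<open>g\<close> is \<open>k\<close> times continuously differentiable iff all of them are.\<close>

primrec cont_differentiable :: "nat \<Rightarrow> (real^'n \<Rightarrow> real) \<Rightarrow> bool" where
  "cont_differentiable 0 g \<longleftrightarrow> continuous_on UNIV g"
| "cont_differentiable (Suc k) g \<longleftrightarrow>
     (\<forall>x. g differentiable (at x)) \<and> (\<forall>i. cont_differentiable k (partial_deriv i g))"

text \<open>The index tuple \<open>(i\<^sub>1, \<dots>, i\<^sub>k)\<close> is the list \<open>is\<close>; \<open>foldr\<close> applies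
  \<open>\<partial>\<^bsub>i\<^sub>k\<^esub>\<close> first, as in \<open>\<partial>\<^bsub>i\<^sub>1\<^esub> \<dots> \<partial>\<^bsub>i\<^sub>k\<^esub> g\<close>. There are
  finitely many such lists because the index type is finite.\<close>

definition kth_differential :: "nat \<Rightarrow> (real^'n \<Rightarrow> real) \<Rightarrow> real^'n \<Rightarrow> real^'n \<Rightarrow> real" where
  "kth_differential k g x d =
     (\<Sum>is | length is = k. foldr partial_deriv is g x * (\<Prod>i\<leftarrow>is. d $ i))"

definition piecewise_cont_differentiable ::
  "nat \<Rightarrow> (real^'n \<Rightarrow> real) \<Rightarrow> nat \<Rightarrow> (nat \<Rightarrow> real^'n \<Rightarrow> real) \<Rightarrow> bool" where
  "piecewise_cont_differentiable p f m fs \<longleftrightarrow>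
     continuous_on UNIV f \<and>
     (\<forall>i\<in>{1..m}. cont_differentiable p (fs i)) \<and>
     (\<forall>x. f x \<in> {fs i x | i. i \<in> {1..m}})"

definition active_set ::
  "(real^'n \<Rightarrow> real) \<Rightarrow> nat \<Rightarrow> (nat \<Rightarrow> real^'n \<Rightarrow> real) \<Rightarrow> real^'n \<Rightarrow> nat set" where
  "active_set f m fs x = {i \<in> {1..m}. f x = fs i x}"

definition active_directions ::
  "(real^'n \<Rightarrow> real) \<Rightarrow> nat \<Rightarrow> (nat \<Rightarrow> real^'n \<Rightarrow> real) \<Rightarrow> nat \<Rightarrow> real^'n \<Rightarrow> (real^'n) set" where
  "active_directions f m fs i x =
     {d. \<exists>(ds :: nat \<Rightarrow> real^'n) (t :: nat \<Rightarrow> real).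
           (\<forall>j. t j > 0) \<and> ds \<longlonglongrightarrow> d \<and> t \<longlonglongrightarrow> 0 \<and>
           (\<forall>j. i \<in> active_set f m fs (x + t j *\<^sub>R ds j))}"

text \<open>\<open>GDERIV f (y k) :> g k\<close> says both that \<open>f\<close> is differentiable at \<open>y k\<close> and that
  \<open>g k\<close> is its gradient there.\<close>

definition clarke_subdifferential :: "(real^'n \<Rightarrow> real) \<Rightarrow> real^'n \<Rightarrow> (real^'n) set" where
  "clarke_subdifferential f x =
     convex hull {\<xi>. \<exists>(y :: nat \<Rightarrow> real^'n) (g :: nat \<Rightarrow> real^'n).
                       (\<forall>k. GDERIV f (y k) :> g k) \<and> y \<longlonglongrightarrow> x \<and> g \<longlonglongrightarrow> \<xi>}"

definition minimum_of_order :: "nat \<Rightarrow> real \<Rightarrow> (real^'n \<Rightarrow> real) \<Rightarrow> real^'n \<Rightarrow> bool" where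
  "minimum_of_order p \<beta> f xs \<longleftrightarrow>
     (\<exists>U. open U \<and> xs \<in> U \<and> (\<forall>x\<in>U. f x \<ge> f xs + \<beta> * norm (x - xs) ^ p))"

text \<open>The limit \<open>d' \<rightarrow> d\<close> admits \<open>d' = d\<close>, hence \<open>nhds d\<close> rather than \<open>at d\<close>.\<close>

definition lower_dir_deriv :: "nat \<Rightarrow> (real^'n \<Rightarrow> real) \<Rightarrow> real^'n \<Rightarrow> real^'n \<Rightarrow> ereal" where
  "lower_dir_deriv p f x d =
     Liminf (at_right 0 \<times>\<^sub>F nhds d) (\<lambda>(t, d'). ereal ((f (x + t *\<^sub>R d') - f x) / t ^ p))"

text \<open>The limit inferior of \<open>\<langle>\<xi>, d'\<rangle> / t\<^bsup>p-1\<^esup>\<close> over \<open>\<xi> \<in> \<partial>f(x + t d')\<close>,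
  \<open>t \<searrow> 0\<close>, \<open>d' \<rightarrow> d\<close>.\<close>

definition clarke_liminf :: "nat \<Rightarrow> (real^'n \<Rightarrow> real) \<Rightarrow> real^'n \<Rightarrow> real^'n \<Rightarrow> ereal" where
  "clarke_liminf p f x d =
     Inf {liminf (\<lambda>k. ereal ((\<xi> k \<bullet> ds k) / t k ^ (p - 1))) |
            (t :: nat \<Rightarrow> real) (ds :: nat \<Rightarrow> real^'n) (\<xi> :: nat \<Rightarrow> real^'n).
            (\<forall>k. t k > 0) \<and> t \<longlonglongrightarrow> 0 \<and> ds \<longlonglongrightarrow> d \<and>
            (\<forall>k. \<xi> k \<in> clarke_subdifferential f (x + t k *\<^sub>R ds k))}"

end

theory Submission
  imports Defs
begin

text \<open>Along a ray from \<open>xs\<close>, expand an active selection function \<open>h\<close> and its directional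
  derivative by Taylor's formula. In \<open>t \<langle>\<nabla>h(xs + t d'), d'\<rangle> - (h(xs + t d') - h(xs))\<close> the
  \<open>k\<close>-th differential appears with the factor \<open>t\<^sup>k (1 / (k - 1)! - 1 / k!)\<close>, which vanishes for
  \<open>k = 1\<close> and is nonnegative for \<open>k \<ge> 2\<close>; hence the difference is at least \<open>- o(t\<^sup>p)\<close>. A
  Clarke subgradient at \<open>x\<close> is bounded below, in any fixed direction, by the derivative of some
  selection function active at \<open>x\<close>, so the estimate passes to \<open>\<langle>\<xi>, d'\<rangle>\<close>.\<close>

section \<open>Differentials of higher order along a ray\<close>

lemma DERIV_along_ray:
  fixes g :: "'a::real_normed_vector \<Rightarrow> real"
  assumes "(g has_derivative D) (at (x + s *\<^sub>R v))"
  shows "((\<lambda>s. g (x + s *\<^sub>R v)) has_real_derivative D v) (at s)"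
proof -
  interpret D: linear D
    using assms by (rule has_derivative_linear)
  have "((\<lambda>s. g (x + s *\<^sub>R v)) has_derivative (\<lambda>s. D (s *\<^sub>R v))) (at s)"
    using assms by (rule has_derivative_compose[rotated]) (auto intro!: derivative_eq_intros)
  then show ?thesis
    by (simp add: has_field_derivative_def D.scaleR mult_commute_abs)
qed

lemma has_derivative_partial_deriv:
  assumes "g differentiable (at x)"
  shows "(g has_derivative (\<lambda>v. \<Sum>i\<in>UNIV. partial_deriv i g x * v $ i)) (at x)"
proof -
  obtain D where D: "(g has_derivative D) (at x)"
    using assms by (auto simp: differentiable_def)
  interpret D: linear D
    using D by (rule has_derivative_linear)
  have D_axis: "partial_deriv i g x = D (axis i 1)" for i
  proof -
    have "((\<lambda>s. g (x + s *\<^sub>R axis i 1)) has_real_derivative D (axis i 1)) (at 0)"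
      using D by (intro DERIV_along_ray) simp
    then show ?thesis
      unfolding partial_deriv_def by (rule DERIV_imp_deriv)
  qed
  have "D v = (\<Sum>i\<in>UNIV. partial_deriv i g x * v $ i)" for v
  proof -
    have "D v = D (\<Sum>i\<in>UNIV. (v $ i) *\<^sub>R axis i 1)"
      by (simp add: basis_expansion flip: scalar_mult_eq_scaleR)
    then show ?thesis
      by (simp add: D.sum D.scaleR D_axis mult.commute)
  qed
  then have "D = (\<lambda>v. \<Sum>i\<in>UNIV. partial_deriv i g x * v $ i)"
    by blast
  with D show ?thesis
    by simp
qed

lemma cont_differentiable_imp_continuous:
  "cont_differentiable k g \<Longrightarrow> continuous_on UNIV g"
  by (cases k) (auto intro!: differentiable_imp_continuous_on
    simp: differentiable_on_def differentiable_at_withinI)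

lemma cont_differentiable_foldr:
  "cont_differentiable (length is + k) g \<Longrightarrow> cont_differentiable k (foldr partial_deriv is g)"
  \<comment> \<open>\<open>foldr\<close> differentiates by the last index first, so removing the
    last entry replaces \<open>g\<close> by one of its partial derivatives and lowers the order by
    one.\<close>
  by (induction "is" arbitrary: g rule: rev_induct) auto

lemma kth_differential_0 [simp]: "kth_differential 0 g x d = g x"
  by (simp add: kth_differential_def)

text \<open>The head of an index list is the derivative taken last. Splitting it off leaves, as
  inner sum, the total derivative of \<open>foldr partial_deriv is g\<close> in direction
  \<open>d\<close>; in this form differentiation along a ray visibly raises the order by
  one.\<close>

lemma kth_differential_Suc:
  "kth_differential (Suc k) g x d =
     (\<Sum>is | length is = k. (\<Sum>i\<in>UNIV. partial_deriv i (foldr partial_deriv is g) x * d $ i) *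
        (\<Prod>i\<leftarrow>is. d $ i))"
proof -
  have *: "{is :: 'n list. length is = Suc k} = (\<lambda>(i, is). i # is) ` (UNIV \<times> {is. length is = k})"
    by (auto simp: length_Suc_conv)
  have "kth_differential (Suc k) g x d =
      (\<Sum>(i, is)\<in>UNIV \<times> {is. length is = k}.
         partial_deriv i (foldr partial_deriv is g) x * (d $ i * (\<Prod>i\<leftarrow>is. d $ i)))"
    unfolding kth_differential_def *
    by (subst sum.reindex) (auto simp: inj_on_def intro!: sum.cong)
  also have "\<dots> = (\<Sum>is | length is = k. \<Sum>i\<in>UNIV.
         partial_deriv i (foldr partial_deriv is g) x * (d $ i * (\<Prod>i\<leftarrow>is. d $ i)))"
    unfolding sum.cartesian_product[symmetric] by (rule sum.swap)
  finally show ?thesis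
    by (simp add: sum_distrib_right mult.assoc)
qed

lemma has_derivative_kth_differential_1:
  assumes "g differentiable (at x)"
  shows "(g has_derivative kth_differential 1 g x) (at x)"
proof -
  have "kth_differential 1 g x = (\<lambda>v. \<Sum>i\<in>UNIV. partial_deriv i g x * v $ i)"
    by (simp add: fun_eq_iff kth_differential_Suc)
  then show ?thesis
    using has_derivative_partial_deriv[OF assms] by simp
qed

text \<open>Restricted to a ray, the differentials form a chain of successive derivatives, which is
  what Maclaurin's formula asks for.\<close>

lemma DERIV_kth_differential:
  assumes "cont_differentiable p g" "k < p"
  shows "((\<lambda>s. kth_differential k g (x + s *\<^sub>R v) v) has_real_derivative
    kth_differential (Suc k) g (x + s *\<^sub>R v) v) (at s)"
proof -
  have "((\<lambda>s. foldr partial_deriv is g (x + s *\<^sub>R v)) has_real_derivative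
      (\<Sum>i\<in>UNIV. partial_deriv i (foldr partial_deriv is g) (x + s *\<^sub>R v) * v $ i)) (at s)"
    if "length is = k" for "is"
  proof (rule DERIV_along_ray, rule has_derivative_partial_deriv)
    have "cont_differentiable (Suc (p - Suc k)) (foldr partial_deriv is g)"
      by (rule cont_differentiable_foldr) (use assms that in simp)
    then show "foldr partial_deriv is g differentiable (at (x + s *\<^sub>R v))"
      by simp
  qed
  then show ?thesis
    \<comment> \<open>Only the differential of order \<open>Suc k\<close> takes the recursive form;
      the products of entries of \<open>v\<close> are constant in \<open>s\<close>.\<close>
    unfolding kth_differential_Suc unfolding kth_differential_def
    by (intro DERIV_sum DERIV_cmult_right) auto
qed

lemma continuous_prod_list:
  fixes f :: "'i \<Rightarrow> 'a::topological_space \<Rightarrow> real"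
  assumes "\<And>i. continuous_on S (f i)"
  shows "continuous_on S (\<lambda>x. \<Prod>i\<leftarrow>is. f i x)"
  by (induction "is") (auto intro!: continuous_intros assms)

text \<open>Continuity is joint because in the Taylor remainders base point and direction move
  together.\<close>

lemma continuous_kth_differential:
  fixes g :: "real^'n \<Rightarrow> real"
  assumes "cont_differentiable p g" "k \<le> p"
  shows "continuous_on UNIV (\<lambda>(x, v). kth_differential k g x v)"
proof -
  have "continuous_on UNIV (\<lambda>z :: (real^'n) \<times> (real^'n). foldr partial_deriv is g (fst z))"
    if "length is = k" for "is"
  proof -
    have "cont_differentiable (p - k) (foldr partial_deriv is g)"
      by (rule cont_differentiable_foldr) (use assms that in simp)
    then show ?thesis
      by (intro continuous_on_compose2[OF cont_differentiable_imp_continuous])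
        (auto intro!: continuous_intros)
  qed
  then show ?thesis
    unfolding kth_differential_def split_beta
    by (intro continuous_intros continuous_prod_list) auto
qed

section \<open>Taylor estimates for a single selection function\<close>

lemma taylor_gap:
  assumes g: "cont_differentiable p g" and "p \<ge> 1" "t > 0"
    and nonneg: "\<And>k. k \<in> {2..p} \<Longrightarrow> kth_differential k g x v \<ge> 0"
  obtains \<sigma> \<tau> where "\<sigma> \<in> {0..t}" "\<tau> \<in> {0..t}"
    "t * kth_differential 1 g (x + t *\<^sub>R v) v - (g (x + t *\<^sub>R v) - g x) \<ge>
       t ^ p * (kth_differential p g (x + \<sigma> *\<^sub>R v) v / fact (p - 1)
              - kth_differential p g (x + \<tau> *\<^sub>R v) v / fact p)"
proof -
  define D where "D k s = kth_differential k g (x + s *\<^sub>R v) v" for k s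
  have DERIV_D: "(D k has_real_derivative D (Suc k) s) (at s)" if "k < p" for k s
    using DERIV_kth_differential[OF g that] by (simp add: D_def[abs_def])
  obtain q where p: "p = Suc q"
    using \<open>p \<ge> 1\<close> by (cases p) auto
  \<comment> \<open>The derivative \<open>D 1\<close> is expanded to order \<open>q = p - 1\<close>
    and the function \<open>D 0\<close> to order \<open>p\<close>: both remainders then contain the
    \<open>p\<close>-th differential, and after multiplying the first expansion by \<open>t\<close>
    both carry \<open>t ^ p\<close>.\<close>
  obtain \<sigma> where \<sigma>: "0 < \<sigma>" "\<sigma> \<le> t"
    "D 1 t = (\<Sum>m<q. D (Suc m) 0 / fact m * t ^ m) + D (Suc q) \<sigma> / fact q * t ^ q"
    using Maclaurin2[of t "\<lambda>m. D (Suc m)" "D 1" q] \<open>t > 0\<close> DERIV_D p by auto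
  obtain \<tau> where \<tau>: "0 < \<tau>" "\<tau> \<le> t"
    "D 0 t = (\<Sum>m<p. D m 0 / fact m * t ^ m) + D p \<tau> / fact p * t ^ p"
    using Maclaurin2[of t D "D 0" p] \<open>t > 0\<close> DERIV_D by auto
  have "t * D 1 t - (D 0 t - D 0 0) - t ^ p * (D p \<sigma> / fact q - D p \<tau> / fact p) =
     (\<Sum>m<q. D (Suc m) 0 * t ^ Suc m * (1 / fact m - 1 / fact (Suc m)))"
    unfolding \<sigma>(3) \<tau>(3) p sum.lessThan_Suc_shift
    by (simp add: algebra_simps sum_distrib_left sum_subtractf del: fact_Suc)
  also have "\<dots> \<ge> 0"
  proof (rule sum_nonneg)
    fix m assume "m \<in> {..<q}"
    show "0 \<le> D (Suc m) 0 * t ^ Suc m * (1 / fact m - 1 / fact (Suc m))"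
    \<comment> \<open>For \<open>m = 0\<close> the bracket is 1 - 1 = 0, whatever the sign of the
      first differential. Otherwise \<open>Suc m\<close> lies in \<open>{2..p}\<close> and
      \<open>nonneg\<close> applies.\<close>
    proof (cases "m = 0")
      case False
      then have "D (Suc m) 0 \<ge> 0"
        using nonneg[of "Suc m"] \<open>m \<in> {..<q}\<close> p by (simp add: D_def)
      moreover have "1 / fact (Suc m) \<le> (1 / fact m :: real)"
        by (intro divide_left_mono fact_mono) auto
      ultimately show ?thesis
        using \<open>t > 0\<close> by (intro mult_nonneg_nonneg) auto
    qed simp
  qed
  finally show ?thesis
    using \<sigma> \<tau> by (intro that[of \<sigma> \<tau>]) (auto simp: D_def p)
qed

text \<open>As \<open>t\<close> tends to 0 and \<open>v\<close> to \<open>d\<close>, both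
  \<open>p\<close>-th differentials in \<open>taylor_gap\<close> approach \<open>K\<close>, so the
  bracket there approaches \<open>K / fact (p - 1) - K / fact p\<close>, which is nonnegative. It is
  thus eventually at least \<open>- \<epsilon>\<close>, and division by \<open>t ^ p\<close> gives
  the claim.\<close>

lemma eventually_derivative_ge_quotient:
  fixes g :: "real^'n \<Rightarrow> real"
  assumes g: "cont_differentiable p g" and "p \<ge> 1" "\<epsilon> > 0" and "open V" "d \<in> V"
    and nonneg: "\<And>k v. k \<in> {2..p} \<Longrightarrow> v \<in> V \<Longrightarrow> kth_differential k g x v \<ge> 0"
  shows "\<forall>\<^sub>F (t, v) in at_right 0 \<times>\<^sub>F nhds d.
    kth_differential 1 g (x + t *\<^sub>R v) v / t ^ (p - 1) \<ge> (g (x + t *\<^sub>R v) - g x) / t ^ p - \<epsilon>"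
proof -
  define K where "K = kth_differential p g x d"
  define F where "F = (\<lambda>(s, v). kth_differential p g (x + s *\<^sub>R v) v)"
  have "continuous_on UNIV (\<lambda>z. (\<lambda>(x, v). kth_differential p g x v) (x + fst z *\<^sub>R snd z, snd z))"
    by (rule continuous_on_compose2[OF continuous_kth_differential[OF g order_refl]])
      (auto intro!: continuous_intros)
  then have "continuous_on UNIV F"
    by (simp add: F_def split_beta)
  then have "isCont F (0, d)"
    by (simp add: continuous_on_eq_continuous_at)
  then have "(F \<longlongrightarrow> F (0, d)) (nhds (0, d))"
    unfolding continuous_at tendsto_at_iff_tendsto_nhds .
  then have "\<forall>\<^sub>F z in nhds 0 \<times>\<^sub>F nhds d. dist (F z) (F (0, d)) < \<epsilon> / 2"
    unfolding nhds_prod[symmetric] using \<open>\<epsilon> > 0\<close> by (intro tendstoD) auto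
  then obtain P Q where P: "eventually P (nhds (0::real))" and Q: "eventually Q (nhds d)"
    and PQ: "\<And>s v. P s \<Longrightarrow> Q v \<Longrightarrow> dist (F (s, v)) (F (0, d)) < \<epsilon> / 2"
    by (auto simp: eventually_prod_filter)
  \<comment> \<open>A ball around 0 is chosen so that \<open>t < r\<close> also controls the
    intermediate points in \<open>{0..t}\<close>.\<close>
  obtain r where "r > 0" and r: "\<And>s. dist s 0 < r \<Longrightarrow> P s"
    using P by (auto simp: eventually_nhds_metric)
  have "\<forall>\<^sub>F t in at_right 0. t \<in> {0<..<r}"
    using \<open>r > 0\<close> by (auto simp: eventually_at_right_field)
  moreover have "\<forall>\<^sub>F v in nhds d. Q v \<and> v \<in> V"
    using Q eventually_nhds_in_open[OF \<open>open V\<close> \<open>d \<in> V\<close>] by eventually_elim auto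
  ultimately have "\<forall>\<^sub>F z in at_right 0 \<times>\<^sub>F nhds d. fst z \<in> {0<..<r} \<and> Q (snd z) \<and> snd z \<in> V"
    by (auto intro!: eventually_prodI simp: case_prod_beta eventually_prod_filter)
  then show ?thesis
  proof eventually_elim
    case (elim z)
    obtain t v where z: "z = (t, v)"
      by fastforce
    have t: "t > 0" "t < r" and v: "Q v" "v \<in> V"
      using elim z by auto
    obtain \<sigma> \<tau> where \<sigma>: "\<sigma> \<in> {0..t}" and \<tau>: "\<tau> \<in> {0..t}" and gap:
      "t * kth_differential 1 g (x + t *\<^sub>R v) v - (g (x + t *\<^sub>R v) - g x) \<ge>
         t ^ p * (F (\<sigma>, v) / fact (p - 1) - F (\<tau>, v) / fact p)"
      using taylor_gap[OF g \<open>p \<ge> 1\<close> \<open>t > 0\<close>] nonneg v(2) unfolding F_def by force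
    \<comment> \<open>Each of the two remainders may cost \<open>\<epsilon> / 2\<close>; dividing by
      a factorial, which is at least 1, does not enlarge the error.\<close>
    have near: "\<bar>F (s, v) / fact k - K / fact k\<bar> \<le> \<epsilon> / 2" if "s \<in> {0..t}" for s k
    proof -
      have "\<bar>F (s, v) - K\<bar> < \<epsilon> / 2"
        using PQ[OF r v(1), of s] that t by (auto simp: dist_real_def K_def F_def)
      then have "\<bar>F (s, v) - K\<bar> / fact k \<le> \<epsilon> / 2 / 1"
        using \<open>\<epsilon> > 0\<close> by (intro frac_le) auto
      then show ?thesis
        by (simp flip: diff_divide_distrib)
    qed
    have "K / fact (p - 1) - K / fact p \<ge> 0"
    \<comment> \<open>For \<open>p = 1\<close> both factorials are 1 and the difference vanishes;
      for larger \<open>p\<close> the sign condition at order \<open>p\<close> gives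
      \<open>K \<ge> 0\<close>.\<close>
    proof (cases "p = 1")
      case False
      then have "K \<ge> 0"
        using nonneg[of p d] \<open>p \<ge> 1\<close> \<open>d \<in> V\<close> by (simp add: K_def)
      moreover have "fact (p - 1) \<le> (fact p :: real)"
        by (intro fact_mono) simp
      ultimately show ?thesis
        by (simp add: divide_left_mono)
    qed simp
    then have "F (\<sigma>, v) / fact (p - 1) - F (\<tau>, v) / fact p \<ge> - \<epsilon>"
      using near[OF \<sigma>, of "p - 1"] near[OF \<tau>, of p] by linarith
    then have "t ^ p * (F (\<sigma>, v) / fact (p - 1) - F (\<tau>, v) / fact p) \<ge> t ^ p * (- \<epsilon>)"
      using t by (intro mult_left_mono) auto
    with gap have "t * kth_differential 1 g (x + t *\<^sub>R v) v \<ge> (g (x + t *\<^sub>R v) - g x) - \<epsilon> * t ^ p"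
      by (simp add: mult.commute)
    then have "t * kth_differential 1 g (x + t *\<^sub>R v) v / t ^ p
        \<ge> ((g (x + t *\<^sub>R v) - g x) - \<epsilon> * t ^ p) / t ^ p"
      using t by (intro divide_right_mono) auto
    moreover have "t ^ p = t * t ^ (p - 1)"
      using \<open>p \<ge> 1\<close> by (simp add: power_eq_if)
    ultimately show ?case
      using t by (simp add: z diff_divide_distrib)
  qed
qed

section \<open>Active selection functions and Clarke subgradients\<close>

context
  fixes f :: "real^'n \<Rightarrow> real" and fs :: "nat \<Rightarrow> real^'n \<Rightarrow> real" and m p :: nat
  assumes piecewise: "piecewise_cont_differentiable p f m fs" and "p \<ge> 1"
begin

lemma isCont_piecewise: "isCont f x"
  using piecewise by (simp add: piecewise_cont_differentiable_def continuous_on_eq_continuous_at)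

lemma cont_differentiable_selection: "i \<in> {1..m} \<Longrightarrow> cont_differentiable p (fs i)"
  using piecewise by (simp add: piecewise_cont_differentiable_def)

lemma isCont_selection: "i \<in> {1..m} \<Longrightarrow> isCont (fs i) x"
  using cont_differentiable_imp_continuous[OF cont_differentiable_selection]
  by (simp add: continuous_on_eq_continuous_at)

lemma has_derivative_selection:
  assumes "i \<in> {1..m}"
  shows "(fs i has_derivative kth_differential 1 (fs i) x) (at x)"
  using cont_differentiable_selection[OF assms] \<open>p \<ge> 1\<close>
  by (cases p) (auto intro!: has_derivative_kth_differential_1 simp del: One_nat_def)

lemma active_set_nonempty: "\<exists>i. i \<in> active_set f m fs x"
  using piecewise by (force simp: piecewise_cont_differentiable_def active_set_def)

text \<open>The continuous function \<open>f - fs i\<close> stays nonzero near a point where it is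
  nonzero. As there are finitely many indices, active sets near \<open>x\<close> are contained in
  the one at \<open>x\<close>.\<close>

lemma inactive_nearby:
  assumes "i \<in> {1..m}" "i \<notin> active_set f m fs x"
  shows "\<forall>\<^sub>F y in nhds x. i \<notin> active_set f m fs y"
proof -
  have "((\<lambda>y. f y - fs i y) \<longlongrightarrow> f x - fs i x) (nhds x)"
    using isCont_piecewise[of x] isCont_selection[OF assms(1), of x]
    unfolding continuous_at tendsto_at_iff_tendsto_nhds by (intro tendsto_intros)
  moreover have "f x - fs i x \<noteq> 0"
    using assms by (auto simp: active_set_def)
  ultimately have "\<forall>\<^sub>F y in nhds x. f y - fs i y \<noteq> 0"
    by (rule tendsto_imp_eventually_ne)
  then show ?thesis
    by eventually_elim (auto simp: active_set_def)
qed

text \<open>Suppose every index active at \<open>y\<close> had another slope along \<open>v\<close>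
  than \<open>f\<close>. Then \<open>f - fs i\<close>, which is 0 at \<open>y\<close>, would be
  nonzero at \<open>y + s *\<^sub>R v\<close> for small \<open>s \<noteq> 0\<close>. Indices
  inactive at \<open>y\<close> stay inactive, so no index would be active there. The index found
  depends on \<open>v\<close>.\<close>

lemma gradient_eq_active_derivative:
  assumes "GDERIV f y :> g"
  shows "\<exists>i\<in>active_set f m fs y. g \<bullet> v = kth_differential 1 (fs i) y v"
proof (rule ccontr)
  assume contra: "\<not> ?thesis"
  have ray: "((\<lambda>s::real. y + s *\<^sub>R v) \<longlongrightarrow> y) (at 0)"
    by (auto intro!: tendsto_eq_intros)
  have "\<forall>\<^sub>F s in at 0. i \<notin> active_set f m fs (y + s *\<^sub>R v)" if i: "i \<in> {1..m}" for i
  proof (cases "i \<in> active_set f m fs y")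
    case True
    have "(f has_derivative (\<lambda>h. h \<bullet> g)) (at (y + 0 *\<^sub>R v))"
      using assms by (simp add: gderiv_def)
    from DERIV_along_ray[OF this]
    have "((\<lambda>s. f (y + s *\<^sub>R v)) has_real_derivative g \<bullet> v) (at 0)"
      by (simp add: inner_commute)
    moreover have "((\<lambda>s. fs i (y + s *\<^sub>R v)) has_real_derivative kth_differential 1 (fs i) y v) (at 0)"
      using DERIV_along_ray[where x = y and s = 0 and v = v, OF has_derivative_selection[OF i]] by simp
    ultimately have "((\<lambda>s. f (y + s *\<^sub>R v) - fs i (y + s *\<^sub>R v)) has_real_derivative
        g \<bullet> v - kth_differential 1 (fs i) y v) (at 0)"
      by (rule DERIV_diff)
    then have "((\<lambda>s. (f (y + s *\<^sub>R v) - fs i (y + s *\<^sub>R v)) / s) \<longlongrightarrow>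
        g \<bullet> v - kth_differential 1 (fs i) y v) (at 0)"
      \<comment> \<open>Activity of \<open>i\<close> at \<open>y\<close> removes the value at
        \<open>s = 0\<close> from the difference quotient.\<close>
      using True by (simp add: has_field_derivative_iff active_set_def)
    moreover have "g \<bullet> v - kth_differential 1 (fs i) y v \<noteq> 0"
      using contra True by auto
    ultimately have "\<forall>\<^sub>F s in at 0. (f (y + s *\<^sub>R v) - fs i (y + s *\<^sub>R v)) / s \<noteq> 0"
      by (rule tendsto_imp_eventually_ne)
    then show ?thesis
      by eventually_elim (auto simp: active_set_def)
  next
    case False
    with inactive_nearby[OF i] ray show ?thesis
      by (auto simp: filterlim_iff)
  qed
  then have "\<forall>\<^sub>F s in at (0::real). \<forall>i\<in>{1..m}. i \<notin> active_set f m fs (y + s *\<^sub>R v)"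
    by (intro eventually_ball_finite) auto
  then have "\<forall>\<^sub>F s in at (0::real). False"
  proof eventually_elim
    case (elim s)
    obtain i where "i \<in> active_set f m fs (y + s *\<^sub>R v)"
      using active_set_nonempty by blast
    with elim show False
      by (auto simp: active_set_def)
  qed
  then show False
    by simp
qed

text \<open>For a limit of gradients, an index matching the slope along the sequence must survive in
  the limit, since the indices are finitely many and the derivatives \<open>D i\<close> are
  continuous. Convex combinations then preserve only a lower bound, hence an inequality.\<close>

lemma clarke_subgradient_ge_active_derivative:
  assumes "\<xi> \<in> clarke_subdifferential f x"
  obtains i where "i \<in> active_set f m fs x" "\<xi> \<bullet> v \<ge> kth_differential 1 (fs i) x v"
proof -
  define D where "D i y = kth_differential 1 (fs i) y v" for i y
  define S where "S = active_set f m fs x"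
  have S: "finite S" "S \<noteq> {}"
    using active_set_nonempty[of x] by (auto simp: S_def active_set_def)
  have "\<exists>i\<in>S. D i x \<le> \<eta> \<bullet> v"
    if grad: "\<And>k. GDERIV f (y k) :> g k" and y: "y \<longlonglongrightarrow> x" and g: "g \<longlonglongrightarrow> \<eta>" for y g \<eta>
  proof (rule ccontr)
    assume contra: "\<not> ?thesis"
    have "\<forall>\<^sub>F k in sequentially. i \<in> active_set f m fs (y k) \<longrightarrow> g k \<bullet> v \<noteq> D i (y k)"
      if i: "i \<in> {1..m}" for i
    proof (cases "i \<in> S")
      case True
      have "continuous_on UNIV (\<lambda>y. (\<lambda>(x, v). kth_differential 1 (fs i) x v) (y, v))"
        by (rule continuous_on_compose2[OF continuous_kth_differential[OF
            cont_differentiable_selection[OF i] \<open>p \<ge> 1\<close>]]) (auto intro!: continuous_intros)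
      then have "isCont (D i) x"
        by (simp add: D_def[abs_def] continuous_on_eq_continuous_at)
      then have "(\<lambda>k. D i (y k) - g k \<bullet> v) \<longlonglongrightarrow> D i x - \<eta> \<bullet> v"
        using g isCont_tendsto_compose[OF _ y] by (intro tendsto_intros)
      moreover have "D i x - \<eta> \<bullet> v \<noteq> 0"
        using contra True by auto
      ultimately have "\<forall>\<^sub>F k in sequentially. D i (y k) - g k \<bullet> v \<noteq> 0"
        by (rule tendsto_imp_eventually_ne)
      then show ?thesis
        by eventually_elim auto
    next
      case False
      then have "\<forall>\<^sub>F k in sequentially. i \<notin> active_set f m fs (y k)"
        using inactive_nearby[OF i, of x] y by (auto simp: S_def filterlim_iff)
      then show ?thesis
        by eventually_elim auto
    qed
    then have "\<forall>\<^sub>F k in sequentially.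
        \<forall>i\<in>{1..m}. i \<in> active_set f m fs (y k) \<longrightarrow> g k \<bullet> v \<noteq> D i (y k)"
      by (intro eventually_ball_finite) auto
    then have "\<forall>\<^sub>F k in sequentially. False"
    proof eventually_elim
      case (elim k)
      obtain i where "i \<in> active_set f m fs (y k)" "g k \<bullet> v = D i (y k)"
        using gradient_eq_active_derivative[OF grad] unfolding D_def by blast
      with elim show False
        by (auto simp: active_set_def)
    qed
    then show False
      by simp
  qed
  \<comment> \<open>A half-space is convex, so it contains the hull once it contains the limits of
    gradients. Its threshold is a minimum over a finite nonempty set, hence attained by some active
    index.\<close>
  then have "clarke_subdifferential f x \<subseteq> {\<eta>. v \<bullet> \<eta> \<ge> Min ((\<lambda>i. D i x) ` S)}"
    unfolding clarke_subdifferential_def using S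
    by (intro hull_minimal convex_halfspace_ge) (auto simp: Min_le_iff inner_commute)
  with assms S have "\<exists>i\<in>S. D i x \<le> \<xi> \<bullet> v"
    by (auto simp: Min_le_iff inner_commute)
  then show ?thesis
    using that by (auto simp: S_def D_def)
qed

section \<open>Active directions and comparison of the two lower limits\<close>

lemma active_directionsI:
  assumes "\<And>k. t k > 0" "t \<longlonglongrightarrow> 0" "ds \<longlonglongrightarrow> d"
    and "\<exists>\<^sub>F k in sequentially. i \<in> active_set f m fs (x + t k *\<^sub>R ds k)"
  shows "d \<in> active_directions f m fs i x"
proof -
  \<comment> \<open>\<open>active_directions\<close> demands activity at every index of its
    sequences, so the infinitely many good indices are enumerated as a subsequence.\<close>
  obtain r :: "nat \<Rightarrow> nat" where "strict_mono r"
    and "\<And>k. i \<in> active_set f m fs (x + t (r k) *\<^sub>R ds (r k))"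
    using assms(4) infinite_enumerate[of "{k. i \<in> active_set f m fs (x + t k *\<^sub>R ds k)}"]
    by (auto simp: frequently_cofinite cofinite_eq_sequentially[symmetric])
  moreover have "(ds \<circ> r) \<longlonglongrightarrow> d" "(t \<circ> r) \<longlonglongrightarrow> 0"
    using assms \<open>strict_mono r\<close> by (auto intro: LIMSEQ_subseq_LIMSEQ)
  ultimately show ?thesis
    unfolding active_directions_def using assms(1)
    by (intro CollectI exI[of _ "ds \<circ> r"] exI[of _ "t \<circ> r"]) auto
qed

text \<open>Fix one competing sequence. An index active infinitely often along it makes
  \<open>d\<close> an active direction, so the Taylor estimate applies to it; every other index is
  eventually inactive. Finiteness makes the estimates simultaneous, and each subgradient selects an
  index active at its own point.\<close>

lemma lower_dir_deriv_le_clarke_liminf: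
  assumes "d \<noteq> 0"
    and V: "\<And>i. i \<in> {1..m} \<Longrightarrow> \<exists>V. open V \<and> active_directions f m fs i x - {0} \<subseteq> V \<and>
           (\<forall>k\<in>{2..p}. \<forall>d\<in>V. kth_differential k (fs i) x d \<ge> 0)"
  shows "lower_dir_deriv p f x d \<le> clarke_liminf p f x d"
  unfolding clarke_liminf_def
proof (rule Inf_greatest, clarify)
  fix t :: "nat \<Rightarrow> real" and ds \<xi> :: "nat \<Rightarrow> real^'n"
  assume t: "\<forall>k. t k > 0" "t \<longlonglongrightarrow> 0" and ds: "ds \<longlonglongrightarrow> d"
    and \<xi>: "\<forall>k. \<xi> k \<in> clarke_subdifferential f (x + t k *\<^sub>R ds k)"
  have lim: "filterlim (\<lambda>k. (t k, ds k)) (at_right 0 \<times>\<^sub>F nhds d) sequentially"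
    using t ds by (intro filterlim_Pair) (auto simp: filterlim_at less_imp_not_eq2)
  have lim_x: "(\<lambda>k. x + t k *\<^sub>R ds k) \<longlonglongrightarrow> x"
    using t ds by (auto intro!: tendsto_eq_intros)
  have active: "\<forall>\<^sub>F k in sequentially. i \<in> active_set f m fs (x + t k *\<^sub>R ds k) \<longrightarrow>
      kth_differential 1 (fs i) (x + t k *\<^sub>R ds k) (ds k) / t k ^ (p - 1)
        \<ge> (f (x + t k *\<^sub>R ds k) - f x) / t k ^ p - \<epsilon>"
    if i: "i \<in> {1..m}" and "\<epsilon> > 0" for i \<epsilon>
  proof (cases "\<exists>\<^sub>F k in sequentially. i \<in> active_set f m fs (x + t k *\<^sub>R ds k)")
    case True
    then have "d \<in> active_directions f m fs i x"
      using t ds by (intro active_directionsI) auto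
    with V[OF i] \<open>d \<noteq> 0\<close> obtain V where "open V" "d \<in> V"
      and "\<And>k v. k \<in> {2..p} \<Longrightarrow> v \<in> V \<Longrightarrow> kth_differential k (fs i) x v \<ge> 0"
      by blast
    from eventually_derivative_ge_quotient[OF cont_differentiable_selection[OF i] \<open>p \<ge> 1\<close> \<open>\<epsilon> > 0\<close> this]
    have quot: "\<forall>\<^sub>F k in sequentially. kth_differential 1 (fs i) (x + t k *\<^sub>R ds k) (ds k) / t k ^ (p - 1)
        \<ge> (fs i (x + t k *\<^sub>R ds k) - fs i x) / t k ^ p - \<epsilon>"
      using lim by (auto simp: filterlim_iff)
    \<comment> \<open>Frequent activity along a sequence tending to \<open>x\<close> forces activity
      at \<open>x\<close>, so the quotient of \<open>fs i\<close> becomes that of \<open>f\<close>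
      wherever \<open>i\<close> is active.\<close>
    have "f x = fs i x"
    proof (rule ccontr)
      assume "f x \<noteq> fs i x"
      then have "\<forall>\<^sub>F y in nhds x. i \<notin> active_set f m fs y"
        by (intro inactive_nearby i) (auto simp: active_set_def)
      with lim_x True show False
        by (auto simp: filterlim_iff frequently_def)
    qed
    with quot show ?thesis
      by (auto simp: active_set_def elim!: eventually_mono)
  next
    case False
    then have "\<forall>\<^sub>F k in sequentially. i \<notin> active_set f m fs (x + t k *\<^sub>R ds k)"
      by (simp add: not_frequently)
    then show ?thesis
      by eventually_elim auto
  qed
  show "lower_dir_deriv p f x d \<le> liminf (\<lambda>k. ereal (\<xi> k \<bullet> ds k / t k ^ (p - 1)))"
    unfolding le_Liminf_iff
  proof (intro allI impI)
    fix y assume "y < lower_dir_deriv p f x d"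
    \<comment> \<open>The lower limits may be infinite, so two real levels \<open>r < r'\<close> are
      inserted; their gap \<open>r' - r\<close> serves as the error in
      \<open>active\<close>.\<close>
    then obtain r where r: "y < ereal r" "ereal r < lower_dir_deriv p f x d"
      using ereal_dense2 by blast
    then obtain r' where r': "r < r'" "ereal r' < lower_dir_deriv p f x d"
      using ereal_dense2[OF r(2)] by auto
    have "\<forall>\<^sub>F z in at_right 0 \<times>\<^sub>F nhds d. ereal r' < (\<lambda>(t, v). ereal ((f (x + t *\<^sub>R v) - f x) / t ^ p)) z"
      using r'(2) by (auto simp: lower_dir_deriv_def dest: less_LiminfD)
    then have quot: "\<forall>\<^sub>F k in sequentially. r' < (f (x + t k *\<^sub>R ds k) - f x) / t k ^ p"
      using lim by (auto simp: filterlim_iff)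
    have "\<forall>\<^sub>F k in sequentially. \<forall>i\<in>{1..m}. i \<in> active_set f m fs (x + t k *\<^sub>R ds k) \<longrightarrow>
      kth_differential 1 (fs i) (x + t k *\<^sub>R ds k) (ds k) / t k ^ (p - 1)
        \<ge> (f (x + t k *\<^sub>R ds k) - f x) / t k ^ p - (r' - r)"
      using r'(1) active by (intro eventually_ball_finite) auto
    with quot show "\<forall>\<^sub>F k in sequentially. y < ereal (\<xi> k \<bullet> ds k / t k ^ (p - 1))"
    proof eventually_elim
      case (elim k)
      obtain i where i: "i \<in> active_set f m fs (x + t k *\<^sub>R ds k)"
        and ge: "\<xi> k \<bullet> ds k \<ge> kth_differential 1 (fs i) (x + t k *\<^sub>R ds k) (ds k)"
        using clarke_subgradient_ge_active_derivative \<xi> by blast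
      have "r < (f (x + t k *\<^sub>R ds k) - f x) / t k ^ p - (r' - r)"
        using elim(1) by simp
      also have "\<dots> \<le> kth_differential 1 (fs i) (x + t k *\<^sub>R ds k) (ds k) / t k ^ (p - 1)"
        using elim(2) i by (auto simp: active_set_def)
      also have "\<dots> \<le> \<xi> k \<bullet> ds k / t k ^ (p - 1)"
        using ge t by (intro divide_right_mono) (auto simp: less_imp_le)
      finally have "ereal r < ereal (\<xi> k \<bullet> ds k / t k ^ (p - 1))"
        by simp
      with r(1) show ?case
        by (rule less_trans)
    qed
  qed
qed

end

section \<open>Growth at a minimum of order \<open>p\<close>\<close>

lemma minimum_of_order_imp_le_lower_dir_deriv:
  fixes f :: "real^'n \<Rightarrow> real"
  assumes "minimum_of_order p \<beta> f x"
  shows "ereal (\<beta> * norm d ^ p) \<le> lower_dir_deriv p f x d"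
proof -
  let ?F = "at_right (0::real) \<times>\<^sub>F nhds d"
  obtain U where U: "open U" "x \<in> U" "\<And>y. y \<in> U \<Longrightarrow> f y \<ge> f x + \<beta> * norm (y - x) ^ p"
    using assms by (auto simp: minimum_of_order_def)
  have fst: "filterlim fst (at_right 0) ?F" and snd: "(snd \<longlongrightarrow> d) ?F"
    by (rule filterlim_fst, rule filterlim_snd)
  have fst0: "(fst \<longlongrightarrow> 0) ?F"
    using fst by (simp add: filterlim_at)
  have "((\<lambda>z. x + fst z *\<^sub>R snd z) \<longlongrightarrow> x) ?F"
    using tendsto_add[OF tendsto_const tendsto_scaleR[OF fst0 snd], of x] by simp
  then have "\<forall>\<^sub>F z in ?F. x + fst z *\<^sub>R snd z \<in> U"
    using U by (intro topological_tendstoD)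
  moreover have "\<forall>\<^sub>F z in ?F. fst z > 0"
    using fst by (auto simp: filterlim_at elim: eventually_mono)
  \<comment> \<open>The growth term at \<open>x + t *\<^sub>R v\<close> is
    \<open>\<beta> * t ^ p * norm v ^ p\<close>; division by \<open>t ^ p\<close> leaves a bound
    that is continuous in \<open>v\<close>.\<close>
  ultimately have "\<forall>\<^sub>F z in ?F. ereal (\<beta> * norm (snd z) ^ p)
      \<le> (\<lambda>(t, v). ereal ((f (x + t *\<^sub>R v) - f x) / t ^ p)) z"
  proof eventually_elim
    case (elim z)
    then show ?case
      using U(3)[OF elim(1)]
      by (auto simp: split_beta field_simps power_mult_distrib)
  qed
  then have "Liminf ?F (\<lambda>z. ereal (\<beta> * norm (snd z) ^ p)) \<le> lower_dir_deriv p f x d"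
    unfolding lower_dir_deriv_def by (rule Liminf_mono)
  moreover have "((\<lambda>z. ereal (\<beta> * norm (snd z) ^ p)) \<longlongrightarrow> ereal (\<beta> * norm d ^ p)) ?F"
    using snd by (intro tendsto_intros)
  then have "Liminf ?F (\<lambda>z. ereal (\<beta> * norm (snd z) ^ p)) = ereal (\<beta> * norm d ^ p)"
    by (intro lim_imp_Liminf) (auto simp: prod_filter_eq_bot)
  ultimately show ?thesis
    by simp
qed

theorem lemma3:
  fixes f :: "real^'n \<Rightarrow> real" and fs :: "nat \<Rightarrow> real^'n \<Rightarrow> real"
    and m p :: nat and \<beta> :: real and xs :: "real^'n"
  assumes "m \<ge> 1" and "p \<ge> 1" and "\<beta> > 0"
    and "piecewise_cont_differentiable p f m fs"
    and "minimum_of_order p \<beta> f xs"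
    and "\<forall>i\<in>{1..m}. \<exists>V. open V \<and> active_directions f m fs i xs - {0} \<subseteq> V \<and>
           (\<forall>k\<in>{2..p}. \<forall>d\<in>V. kth_differential k (fs i) xs d \<ge> 0)"
  shows "(\<forall>d. d \<noteq> 0 \<longrightarrow> clarke_liminf p f xs d \<ge> lower_dir_deriv p f xs d) \<and>
         (\<forall>d. d \<noteq> 0 \<longrightarrow> clarke_liminf p f xs d \<ge> ereal (\<beta> * norm d ^ p))"
proof -
  have "lower_dir_deriv p f xs d \<le> clarke_liminf p f xs d" if "d \<noteq> 0" for d
    using assms(6) by (intro lower_dir_deriv_le_clarke_liminf[OF assms(4,2) that]) auto
  then show ?thesis
    using minimum_of_order_imp_le_lower_dir_deriv[OF assms(5)] by (blast intro: order_trans)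
qed

end
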